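(* Let $M=(E,\mathcal{I})$ be a (finite) matroid of rank $r\geqslant 1$. Let $\mathcal{I}_k$ be the collection of independent sets of size $k$, and let $I_k=|\mathcal{I}_k|$ and $I=|\mathcal{I}|$. For a set $F\in \mathcal{I}_{r-1}$ let $\delta(F)$ be the number of bases of $M$ containing $F$. Then $$\ln \left(\frac{I}{I_r}\right)\geqslant \frac{I_{r-1}}{I_r}\cdot \left[\frac{1}{I_{r-1}}\sum_{F\in \mathcal{I}_{r-1}}\delta(F)\ln \left(1+\frac{1}{\delta(F)}\right)\right].$$ In particular, if $\delta>0$ is such that every set $F\in \mathcal{I}_{r-1}$ is contained in at least $\delta$ bases, then $$\ln \left(\frac{I}{I_r}\right)\geqslant \frac{I_{r-1}}{I_r}\cdot \delta \ln \left(1+\frac{1}{\delta}\right).$$ In particular, $$\frac{I}{I_r}\geqslant 2^{I_{r-1}/I_r}.$$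
   Context: A matroid $M=(E,\mathcal{I})$ is given by its finite ground set $E$ and its family $\mathcal{I}$ of independent sets; its bases are the maximal independent sets, all of size equal to the rank $r$. *)

theory Defs
  imports Complex_Main
begin

locale matroid =
  fixes E :: "'a set" and \<I> :: "'a set set"
  assumes finite_ground: "finite E"
    and indep_subset_ground: "\<And>A. A \<in> \<I> \<Longrightarrow> A \<subseteq> E"
    and empty_indep: "{} \<in> \<I>"
    and indep_hereditary: "\<And>A B. A \<in> \<I> \<Longrightarrow> B \<subseteq> A \<Longrightarrow> B \<in> \<I>"
    and indep_augment: "\<And>A B. A \<in> \<I> \<Longrightarrow> B \<in> \<I> \<Longrightarrow> card A < card B
                          \<Longrightarrow> \<exists>x\<in>B - A. insert x A \<in> \<I>"

definition matroid_bases :: "'a set set \<Rightarrow> 'a set set" where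
  "matroid_bases \<I> = {B \<in> \<I>. \<forall>A\<in>\<I>. B \<subseteq> A \<longrightarrow> A = B}"

text \<open>The rank is the common size of the bases; that it is well defined for a matroid is
  \<open>matroid.card_matroid_basis\<close> and \<open>matroid.matroid_basis_exists\<close> below.\<close>

definition matroid_rank :: "'a set set \<Rightarrow> nat" where
  "matroid_rank \<I> = (THE r. card ` matroid_bases \<I> = {r})"

definition indep_of_size :: "'a set set \<Rightarrow> nat \<Rightarrow> 'a set set" where
  "indep_of_size \<I> k = {A \<in> \<I>. card A = k}"

definition num_bases_containing :: "'a set set \<Rightarrow> 'a set \<Rightarrow> nat" where
  "num_bases_containing \<I> F = card {B \<in> matroid_bases \<I>. F \<subseteq> B}"

context matroid
begin

lemma finite_indep_family: "finite \<I>"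
proof (rule finite_subset)
  show "\<I> \<subseteq> Pow E" using indep_subset_ground by blast
  show "finite (Pow E)" using finite_ground by simp
qed

lemma matroid_basis_exists: "matroid_bases \<I> \<noteq> {}"
proof -
  obtain B where "B \<in> \<I>" "\<forall>A\<in>\<I>. B \<subseteq> A \<longrightarrow> A = B"
    using finite_has_maximal[OF finite_indep_family] empty_indep by blast
  then show ?thesis unfolding matroid_bases_def by blast
qed

lemma matroid_bases_same_card:
  assumes "B \<in> matroid_bases \<I>" "C \<in> matroid_bases \<I>"
  shows "card B = card C"
proof -
  have le: "card Y \<le> card X" if "X \<in> matroid_bases \<I>" "Y \<in> matroid_bases \<I>" for X Y
  proof (rule ccontr)
    assume "\<not> card Y \<le> card X"
    moreover have "X \<in> \<I>" "Y \<in> \<I>" using that unfolding matroid_bases_def by auto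
    ultimately obtain x where "x \<in> Y - X" "insert x X \<in> \<I>"
      using indep_augment[of X Y] not_le by blast
    then have "insert x X = X" using that unfolding matroid_bases_def by auto
    then show False using \<open>x \<in> Y - X\<close> by auto
  qed
  show ?thesis by (rule le_antisym) (rule le[OF assms(2) assms(1)], rule le[OF assms])
qed

lemma card_matroid_basis:
  assumes "B \<in> matroid_bases \<I>"
  shows "card B = matroid_rank \<I>"
proof -
  have "card ` matroid_bases \<I> = {card B}"
    using assms matroid_bases_same_card by blast
  then show ?thesis unfolding matroid_rank_def by simp
qed

end

end

theory Submission
  imports Defs "HOL-Analysis.Convex"
begin

text \<open>
  Write \<open>\<delta>\<close> for \<open>num_bases_containing \<I>\<close>. The heart of the proof is that, for every independent \<open>A\<close>,
  the sum over all bases \<open>B \<supseteq> A\<close> of the product of \<open>1 / \<delta> (B - {e})\<close> over \<open>e \<in> B - A\<close> is at most \<open>1\<close>.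
  This goes by downward induction on \<open>card A\<close>: replacing \<open>A\<close> by \<open>insert x A\<close> multiplies the term of
  a basis \<open>B \<ni> x\<close> by \<open>\<delta> (B - {x})\<close>, and by basis exchange the numbers \<open>\<delta> (B - {x})\<close>, \<open>x \<in> B - A\<close>, add up
  to at least the number of elements \<open>x\<close> that extend \<open>A\<close> independently.

  Summing over all \<open>A\<close> and expanding the product shows that the sum over all bases \<open>B\<close> of the product of
  \<open>1 + 1 / \<delta> (B - {e})\<close> over \<open>e \<in> B\<close> is at most \<open>card \<I>\<close>. Concavity of the logarithm and double
  counting of the pairs \<open>(B - {e}, B)\<close> give the first inequality; the others follow since
  \<open>x * ln (1 + 1 / x)\<close> is increasing.
\<close>

section \<open>Two consequences of the concavity of the logarithm\<close>

text \<open>\<open>1 + 1 / y\<close> is the mean of \<open>1\<close> and \<open>1 + 1 / x\<close>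
  with weights \<open>1 - x / y\<close> and \<open>x / y\<close>, and \<open>ln 1 = 0\<close>, so
  concavity gives the bound.\<close>

lemma mult_ln_one_plus_inverse_mono:
  fixes x y :: real
  assumes "0 < x" "x \<le> y"
  shows "x * ln (1 + 1 / x) \<le> y * ln (1 + 1 / y)"
proof -
  have "(1 - x / y) * ln 1 + x / y * ln (1 + 1 / x) \<le> ln ((1 - x / y) *\<^sub>R 1 + (x / y) *\<^sub>R (1 + 1 / x))"
    using assms by (intro concave_onD[OF ln_concave]) (auto simp: add_pos_pos)
  also have "(1 - x / y) *\<^sub>R 1 + (x / y) *\<^sub>R (1 + 1 / x) = 1 + 1 / y"
    using assms by (simp add: field_simps)
  finally show ?thesis using assms by (simp add: field_simps)
qed

text \<open>Jensen's inequality for \<open>ln\<close> with all weights equal to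
  \<open>1 / card S\<close>.\<close>

lemma sum_ln_le_card_mult_ln_mean:
  fixes f :: "'b \<Rightarrow> real"
  assumes "finite S" "S \<noteq> {}" "\<And>i. i \<in> S \<Longrightarrow> 0 < f i"
  shows "(\<Sum>i\<in>S. ln (f i)) \<le> real (card S) * ln ((\<Sum>i\<in>S. f i) / real (card S))"
proof -
  have c: "real (card S) > 0" using assms by (simp add: card_gt_0_iff)
  have "(\<Sum>i\<in>S. 1 / real (card S) * ln (f i)) \<le> ln (\<Sum>i\<in>S. (1 / real (card S)) *\<^sub>R f i)"
    using assms c by (intro concave_on_sum[OF _ _ ln_concave]) auto
  then have "(\<Sum>i\<in>S. ln (f i)) / real (card S) \<le> ln ((\<Sum>i\<in>S. f i) / real (card S))"
    by (simp add: sum_divide_distrib)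
  then show ?thesis using c by (simp add: field_simps)
qed

context matroid
begin

section \<open>Bases, extension and exchange in a matroid\<close>

lemma finite_indep: "A \<in> \<I> \<Longrightarrow> finite A"
  using indep_subset_ground finite_ground finite_subset by blast

lemma basis_indep: "B \<in> matroid_bases \<I> \<Longrightarrow> B \<in> \<I>"
  by (simp add: matroid_bases_def)

lemma finite_basis: "B \<in> matroid_bases \<I> \<Longrightarrow> finite B"
  using basis_indep finite_indep by blast

lemma finite_bases: "finite (matroid_bases \<I>)"
  using finite_indep_family by (simp add: matroid_bases_def)

lemma card_indep_le_basis:
  assumes "A \<in> \<I>" "B \<in> matroid_bases \<I>"
  shows "card A \<le> card B"
proof (rule ccontr)
  assume "\<not> card A \<le> card B"
  then obtain x where "x \<in> A - B" "insert x B \<in> \<I>"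
    using indep_augment[of B A] assms basis_indep not_le by blast
  then show False using assms(2) unfolding matroid_bases_def by auto
qed

text \<open>No independent set is larger than a basis, so one of full size cannot grow.\<close>

lemma bases_eq_indep_of_rank: "matroid_bases \<I> = indep_of_size \<I> (matroid_rank \<I>)"
proof
  show "matroid_bases \<I> \<subseteq> indep_of_size \<I> (matroid_rank \<I>)"
    using card_matroid_basis basis_indep by (auto simp: indep_of_size_def)
next
  show "indep_of_size \<I> (matroid_rank \<I>) \<subseteq> matroid_bases \<I>"
  proof
    fix B assume B: "B \<in> indep_of_size \<I> (matroid_rank \<I>)"
    obtain C where C: "C \<in> matroid_bases \<I>" using matroid_basis_exists by blast
    have "A = B" if A: "A \<in> \<I>" "B \<subseteq> A" for A
      using card_indep_le_basis[OF A(1) C] card_matroid_basis[OF C] B A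
      by (metis (mono_tags, lifting) card_seteq finite_indep indep_of_size_def mem_Collect_eq)
    then show "B \<in> matroid_bases \<I>"
      using B by (auto simp: matroid_bases_def indep_of_size_def)
  qed
qed

lemma card_indep_le_rank: "A \<in> \<I> \<Longrightarrow> card A \<le> matroid_rank \<I>"
  using matroid_basis_exists card_indep_le_basis card_matroid_basis by fastforce

text \<open>\<open>X\<close> is augmented from \<open>Y\<close> one element at a time. The bound
  \<open>Z \<subseteq> X \<union> Y\<close> is what confines the new basis in the exchange
  argument.\<close>

lemma indep_extend:
  assumes "X \<in> \<I>" "Y \<in> \<I>" "card X \<le> card Y"
  shows "\<exists>Z\<in>\<I>. X \<subseteq> Z \<and> Z \<subseteq> X \<union> Y \<and> card Z = card Y"
  using assms
proof (induction "card Y - card X" arbitrary: X)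
  case 0
  then show ?case by auto
next
  case (Suc n)
  then have "card X < card Y" by simp
  then obtain x where x: "x \<in> Y - X" "insert x X \<in> \<I>"
    using indep_augment[OF Suc.prems(1,2)] by blast
  have "card (insert x X) = Suc (card X)" using x Suc.prems finite_indep by auto
  then have "\<exists>Z\<in>\<I>. insert x X \<subseteq> Z \<and> Z \<subseteq> insert x X \<union> Y \<and> card Z = card Y"
    using Suc x by (intro Suc.hyps(1)) auto
  then show ?case using x by auto
qed

text \<open>Growing \<open>insert y A\<close> to full size inside \<open>insert y B\<close> omits
  exactly one element, which lies in \<open>B - A\<close>. If \<open>y\<close> is already in
  \<open>B\<close>, then \<open>x = y\<close> works.\<close>

lemma basis_exchange:
  assumes B: "B \<in> matroid_bases \<I>" and "A \<subseteq> B" "y \<notin> A" "insert y A \<in> \<I>"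
  shows "\<exists>x\<in>B - A. insert y (B - {x}) \<in> matroid_bases \<I>"
proof (cases "y \<in> B")
  case True
  then show ?thesis using assms by (intro bexI[of _ y]) (auto simp: insert_absorb)
next
  case False
  obtain Z where Z: "Z \<in> \<I>" "insert y A \<subseteq> Z" "Z \<subseteq> insert y B" "card Z = card B"
    using indep_extend[OF assms(4) basis_indep[OF B] card_indep_le_basis[OF assms(4) B]]
      \<open>A \<subseteq> B\<close> by blast
  have "card (insert y B - Z) = 1"
    using card_Diff_subset[OF finite_indep[OF Z(1)] Z(3)] Z(4) False finite_basis[OF B] by simp
  then obtain x where x: "insert y B - Z = {x}" by (auto simp: card_1_singleton_iff)
  then have "x \<in> B - A" "insert y (B - {x}) = Z" using Z by auto
  moreover have "Z \<in> matroid_bases \<I>"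
    using Z card_matroid_basis[OF B] by (simp add: bases_eq_indep_of_rank indep_of_size_def)
  ultimately show ?thesis by auto
qed

text \<open>Positivity makes the weights \<open>1 / num_bases_containing \<I> F\<close> true
  reciprocals rather than the default value \<open>0\<close>.\<close>

lemma num_bases_containing_pos:
  assumes "A \<in> \<I>"
  shows "0 < num_bases_containing \<I> A"
proof -
  obtain B where B: "B \<in> matroid_bases \<I>" using matroid_basis_exists by blast
  obtain Z where "Z \<in> \<I>" "A \<subseteq> Z" "card Z = card B"
    using indep_extend[OF assms basis_indep[OF B] card_indep_le_basis[OF assms B]] by blast
  then have "Z \<in> {B \<in> matroid_bases \<I>. A \<subseteq> B}"
    using card_matroid_basis[OF B] by (simp add: bases_eq_indep_of_rank indep_of_size_def)
  then show ?thesis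
    unfolding num_bases_containing_def using finite_bases by (auto simp: card_gt_0_iff)
qed

lemma num_bases_containing_diff_pos:
  "B \<in> matroid_bases \<I> \<Longrightarrow> 0 < num_bases_containing \<I> (B - {x})"
  by (meson Diff_subset basis_indep indep_hereditary num_bases_containing_pos)

text \<open>Exchange puts each \<open>y\<close> extending \<open>A\<close> into some
  \<open>C x\<close>, so a union bound applies; adding \<open>y\<close> to \<open>B - {x}\<close>
  maps \<open>C x\<close> injectively to bases above \<open>B - {x}\<close>.\<close>

lemma card_extensions_le:
  assumes B: "B \<in> matroid_bases \<I>" and "A \<subseteq> B"
  shows "card {y. y \<notin> A \<and> insert y A \<in> \<I>} \<le> (\<Sum>x\<in>B - A. num_bases_containing \<I> (B - {x}))"
proof -
  define C where "C x = {y. y \<notin> B - {x} \<and> insert y (B - {x}) \<in> matroid_bases \<I>}" for x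
  have fin: "finite (C x)" for x
    using finite_subset[OF _ finite_ground, of "C x"] basis_indep indep_subset_ground
    by (auto simp: C_def)
  have "{y. y \<notin> A \<and> insert y A \<in> \<I>} \<subseteq> (\<Union>x\<in>B - A. C x)"
  proof
    fix y assume y: "y \<in> {y. y \<notin> A \<and> insert y A \<in> \<I>}"
    then obtain x where x: "x \<in> B - A" "insert y (B - {x}) \<in> matroid_bases \<I>"
      using basis_exchange[OF assms] by blast
    \<comment> \<open>Otherwise the insertion changes nothing, and \<open>B - {x}\<close> would be a
      basis with too few elements.\<close>
    have "y \<notin> B - {x}"
    proof
      assume "y \<in> B - {x}"
      then have "B - {x} \<in> matroid_bases \<I>" using x by (simp add: insert_absorb)
      then have "card (B - {x}) = card B" using matroid_bases_same_card B by blast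
      then show False using x finite_basis[OF B] by (metis DiffD1 card_Diff1_less less_irrefl)
    qed
    then show "y \<in> (\<Union>x\<in>B - A. C x)" using x by (auto simp: C_def)
  qed
  then have "card {y. y \<notin> A \<and> insert y A \<in> \<I>} \<le> card (\<Union>x\<in>B - A. C x)"
    using fin finite_basis[OF B] by (intro card_mono) auto
  also have "\<dots> \<le> (\<Sum>x\<in>B - A. card (C x))"
    using finite_basis[OF B] by (intro card_UN_le) auto
  also have "\<dots> \<le> (\<Sum>x\<in>B - A. num_bases_containing \<I> (B - {x}))"
  proof (rule sum_mono)
    fix x
    show "card (C x) \<le> num_bases_containing \<I> (B - {x})"
      unfolding num_bases_containing_def
    proof (rule card_inj_on_le)
      show "inj_on (\<lambda>y. insert y (B - {x})) (C x)"
        unfolding inj_on_def C_def by blast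
      show "(\<lambda>y. insert y (B - {x})) ` C x \<subseteq> {B' \<in> matroid_bases \<I>. B - {x} \<subseteq> B'}"
        by (auto simp: C_def)
    qed (use finite_bases in auto)
  qed
  finally show ?thesis .
qed

section \<open>The weighted sum over the bases above an independent set\<close>

lemma sum_prod_inverse_num_bases_le_1:
  assumes "A \<in> \<I>"
  shows "(\<Sum>B | B \<in> matroid_bases \<I> \<and> A \<subseteq> B.
           \<Prod>e\<in>B - A. 1 / real (num_bases_containing \<I> (B - {e}))) \<le> 1"
  using assms
proof (induction "matroid_rank \<I> - card A" arbitrary: A)
  case 0
  \<comment> \<open>Truncated subtraction only yields that the rank is at most
    \<open>card A\<close>; the other bound comes from \<open>card_indep_le_rank\<close>.\<close>
  then have "card A = matroid_rank \<I>" using card_indep_le_rank[of A] by simp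
  then have "A \<in> matroid_bases \<I>"
    using 0 by (simp add: bases_eq_indep_of_rank indep_of_size_def)
  then have "{B. B \<in> matroid_bases \<I> \<and> A \<subseteq> B} = {A}"
    unfolding matroid_bases_def by blast
  then show ?case by simp
next
  case (Suc n)
  define w where
    "w A B = (\<Prod>e\<in>B - A. 1 / real (num_bases_containing \<I> (B - {e})))" for A B
  define N where "N = {y. y \<notin> A \<and> insert y A \<in> \<I>}"
  define S where "S = {B. B \<in> matroid_bases \<I> \<and> A \<subseteq> B}"
  have finN: "finite N"
    using finite_subset[OF _ finite_ground, of N] indep_subset_ground by (auto simp: N_def)
  have finS: "finite S" using finite_bases by (simp add: S_def)
  have "card A < matroid_rank \<I>" using Suc by simp
  moreover obtain C where C: "C \<in> matroid_bases \<I>" using matroid_basis_exists by blast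
  \<comment> \<open>An element of a basis augments \<open>A\<close>, so \<open>N\<close> is nonempty
    and \<open>card N\<close> can be cancelled at the end.\<close>
  ultimately have "\<exists>x\<in>C - A. insert x A \<in> \<I>"
    using indep_augment[OF Suc.prems basis_indep[OF C]] card_matroid_basis[OF C] by simp
  then have "N \<noteq> {}" by (auto simp: N_def)
  then have card_N: "0 < card N" using finN by (simp add: card_gt_0_iff)
  have w_pos: "0 \<le> w A B" for B by (auto simp: w_def intro!: prod_nonneg)
  \<comment> \<open>The aim is to bound the scaled sum by \<open>card N\<close>, the induction
    hypothesis giving at most \<open>1\<close> for each \<open>x\<close> in
    \<open>N\<close>.\<close>
  have "real (card N) * (\<Sum>B\<in>S. w A B) = (\<Sum>B\<in>S. real (card N) * w A B)"
    by (simp add: sum_distrib_left)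
  also have "\<dots> \<le> (\<Sum>B\<in>S. \<Sum>x\<in>B - A. w (insert x A) B)"
  proof (rule sum_mono)
    fix B assume "B \<in> S"
    then have B: "B \<in> matroid_bases \<I>" "A \<subseteq> B" by (auto simp: S_def)
    have "w (insert x A) B = real (num_bases_containing \<I> (B - {x})) * w A B"
      if x: "x \<in> B - A" for x
    proof -
      have "w A B = 1 / real (num_bases_containing \<I> (B - {x})) * w (insert x A) B"
        unfolding w_def using x finite_basis[OF B(1)]
        by (subst prod.remove[of _ x]) (auto simp: Diff_insert[symmetric])
      then show ?thesis using num_bases_containing_diff_pos[OF B(1), of x] by simp
    qed
    then have "(\<Sum>x\<in>B - A. w (insert x A) B)
               = real (\<Sum>x\<in>B - A. num_bases_containing \<I> (B - {x})) * w A B"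
      by (simp add: sum_distrib_right)
    moreover have "card N \<le> (\<Sum>x\<in>B - A. num_bases_containing \<I> (B - {x}))"
      unfolding N_def by (rule card_extensions_le[OF B])
    ultimately show "real (card N) * w A B \<le> (\<Sum>x\<in>B - A. w (insert x A) B)"
      using w_pos by (metis mult_right_mono of_nat_le_iff)
  qed
  \<comment> \<open>As \<open>B\<close> is independent, all elements of \<open>B - A\<close> lie in
    \<open>N\<close>; with this fixed index set the two sums can be swapped.\<close>
  also have "\<dots> = (\<Sum>B\<in>S. \<Sum>x | x \<in> N \<and> x \<in> B. w (insert x A) B)"
  proof (intro sum.cong refl)
    fix B assume "B \<in> S"
    then have "insert x A \<in> \<I>" if "x \<in> B" for x
      using that indep_hereditary[of B "insert x A"] by (auto simp: S_def basis_indep)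
    then show "B - A = {x. x \<in> N \<and> x \<in> B}" by (auto simp: N_def)
  qed
  also have "\<dots> = (\<Sum>x\<in>N. \<Sum>B | B \<in> S \<and> x \<in> B. w (insert x A) B)"
    by (rule sum.swap_restrict[OF finS finN])
  also have "\<dots> \<le> (\<Sum>x\<in>N. 1)"
  proof (rule sum_mono)
    fix x assume x: "x \<in> N"
    then have "card (insert x A) = Suc (card A)"
      using finite_indep[OF Suc.prems] by (simp add: N_def)
    then have "(\<Sum>B | B \<in> matroid_bases \<I> \<and> insert x A \<subseteq> B. w (insert x A) B) \<le> 1"
      unfolding w_def using x Suc.hyps by (intro Suc.hyps(1)) (auto simp: N_def)
    moreover have "{B. B \<in> S \<and> x \<in> B} = {B. B \<in> matroid_bases \<I> \<and> insert x A \<subseteq> B}"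
      by (auto simp: S_def)
    ultimately show "(\<Sum>B | B \<in> S \<and> x \<in> B. w (insert x A) B) \<le> 1" by simp
  qed
  finally have "real (card N) * (\<Sum>B\<in>S. w A B) \<le> real (card N) * 1" by simp
  then have "(\<Sum>B\<in>S. w A B) \<le> 1" using card_N by (subst (asm) mult_le_cancel_left_pos) auto
  then show ?case by (simp add: S_def w_def)
qed

lemma sum_prod_one_plus_inverse_le_card_indep:
  "(\<Sum>B\<in>matroid_bases \<I>. \<Prod>e\<in>B. 1 + 1 / real (num_bases_containing \<I> (B - {e})))
     \<le> real (card \<I>)"
proof -
  define w where
    "w A B = (\<Prod>e\<in>B - A. 1 / real (num_bases_containing \<I> (B - {e})))" for A B
  have "(\<Sum>B\<in>matroid_bases \<I>. \<Prod>e\<in>B. 1 + 1 / real (num_bases_containing \<I> (B - {e})))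
        = (\<Sum>B\<in>matroid_bases \<I>. \<Sum>A | A \<in> \<I> \<and> A \<subseteq> B. w A B)"
  proof (rule sum.cong[OF refl])
    fix B assume B: "B \<in> matroid_bases \<I>"
    have "(\<Prod>e\<in>B. 1 + 1 / real (num_bases_containing \<I> (B - {e}))) = (\<Sum>A\<in>Pow B. w A B)"
      \<comment> \<open>In the expansion, \<open>A\<close> collects the elements contributing the
        summand \<open>1\<close>; those of \<open>B - A\<close> contribute their
        reciprocals.\<close>
      by (subst prod_add[OF finite_basis[OF B]]) (simp add: w_def)
    also have "Pow B = {A. A \<in> \<I> \<and> A \<subseteq> B}"
      using indep_hereditary[OF basis_indep[OF B]] by auto
    finally show "(\<Prod>e\<in>B. 1 + 1 / real (num_bases_containing \<I> (B - {e})))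
                  = (\<Sum>A | A \<in> \<I> \<and> A \<subseteq> B. w A B)" .
  qed
  also have "\<dots> = (\<Sum>A\<in>\<I>. \<Sum>B | B \<in> matroid_bases \<I> \<and> A \<subseteq> B. w A B)"
    by (rule sum.swap_restrict[OF finite_bases finite_indep_family])
  also have "\<dots> \<le> (\<Sum>A\<in>\<I>. 1)"
    unfolding w_def by (intro sum_mono sum_prod_inverse_num_bases_le_1)
  finally show ?thesis by simp
qed

section \<open>Double counting and the logarithmic bound\<close>

text \<open>Both sides sum \<open>g F\<close> over pairs \<open>F \<subseteq> B\<close>, since such
  an \<open>F\<close> is \<open>B - {e}\<close> for a unique \<open>e\<close>. Rank at least
  \<open>1\<close> makes \<open>matroid_rank \<I> - 1\<close> a genuine predecessor.\<close>

lemma sum_bases_sum_diff: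
  fixes g :: "'a set \<Rightarrow> real"
  assumes "1 \<le> matroid_rank \<I>"
  shows "(\<Sum>B\<in>matroid_bases \<I>. \<Sum>e\<in>B. g (B - {e}))
         = (\<Sum>F\<in>indep_of_size \<I> (matroid_rank \<I> - 1). real (num_bases_containing \<I> F) * g F)"
proof -
  let ?H = "indep_of_size \<I> (matroid_rank \<I> - 1)"
  have finH: "finite ?H" using finite_indep_family by (simp add: indep_of_size_def)
  have "(\<Sum>F\<in>?H. real (num_bases_containing \<I> F) * g F)
        = (\<Sum>F\<in>?H. \<Sum>B | B \<in> matroid_bases \<I> \<and> F \<subseteq> B. g F)"
    by (simp add: num_bases_containing_def)
  also have "\<dots> = (\<Sum>B\<in>matroid_bases \<I>. \<Sum>F | F \<in> ?H \<and> F \<subseteq> B. g F)"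
    by (rule sum.swap_restrict[OF finH finite_bases])
  also have "\<dots> = (\<Sum>B\<in>matroid_bases \<I>. \<Sum>e\<in>B. g (B - {e}))"
  proof (rule sum.cong[OF refl])
    fix B assume B: "B \<in> matroid_bases \<I>"
    have "{F. F \<in> ?H \<and> F \<subseteq> B} = (\<lambda>e. B - {e}) ` B"
    proof (intro equalityI subsetI)
      fix F assume F: "F \<in> {F. F \<in> ?H \<and> F \<subseteq> B}"
      then have "card (B - F) = 1"
        using finite_basis[OF B] card_matroid_basis[OF B] assms
        by (auto simp: indep_of_size_def card_Diff_subset finite_indep)
      then obtain e where "B - F = {e}" by (auto simp: card_1_singleton_iff)
      then have "e \<in> B" "F = B - {e}" using F by auto
      then show "F \<in> (\<lambda>e. B - {e}) ` B" by blast
    next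
      fix F assume "F \<in> (\<lambda>e. B - {e}) ` B"
      then show "F \<in> {F. F \<in> ?H \<and> F \<subseteq> B}"
        using card_matroid_basis[OF B] indep_hereditary[OF basis_indep[OF B]]
        by (auto simp: indep_of_size_def)
    qed
    moreover have "inj_on (\<lambda>e. B - {e}) B" by (auto simp: inj_on_def)
    ultimately show "(\<Sum>F | F \<in> ?H \<and> F \<subseteq> B. g F) = (\<Sum>e\<in>B. g (B - {e}))"
      by (simp add: sum.reindex)
  qed
  finally show ?thesis by simp
qed

lemma ln_card_indep_ratio_ge:
  assumes "1 \<le> matroid_rank \<I>"
  shows "(\<Sum>F\<in>indep_of_size \<I> (matroid_rank \<I> - 1).
            real (num_bases_containing \<I> F) * ln (1 + 1 / real (num_bases_containing \<I> F)))
           / real (card (matroid_bases \<I>))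
         \<le> ln (real (card \<I>) / real (card (matroid_bases \<I>)))"
proof -
  let ?p = "\<lambda>B. \<Prod>e\<in>B. 1 + 1 / real (num_bases_containing \<I> (B - {e}))"
  let ?b = "real (card (matroid_bases \<I>))"
  have b: "0 < ?b" using finite_bases matroid_basis_exists by (simp add: card_gt_0_iff)
  have pos: "0 < 1 + 1 / real n" for n by (simp add: add_pos_nonneg)
  then have p: "0 < ?p B" for B by (intro prod_pos) auto
  have nz: "1 + 1 / real n \<noteq> 0" for n using pos[of n] by linarith
  have "(\<Sum>F\<in>indep_of_size \<I> (matroid_rank \<I> - 1).
            real (num_bases_containing \<I> F) * ln (1 + 1 / real (num_bases_containing \<I> F)))
        = (\<Sum>B\<in>matroid_bases \<I>. \<Sum>e\<in>B. ln (1 + 1 / real (num_bases_containing \<I> (B - {e}))))"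
    by (rule sum_bases_sum_diff[OF assms, symmetric])
  also have "\<dots> = (\<Sum>B\<in>matroid_bases \<I>. ln (?p B))"
    using finite_basis by (intro sum.cong refl ln_prod[symmetric]) (auto simp: nz)
  also have "\<dots> \<le> ?b * ln ((\<Sum>B\<in>matroid_bases \<I>. ?p B) / ?b)"
    using finite_bases matroid_basis_exists p by (intro sum_ln_le_card_mult_ln_mean)
  also have "\<dots> \<le> ?b * ln (real (card \<I>) / ?b)"
  proof -
    \<comment> \<open>Monotonicity of \<open>ln\<close> is applied to positive arguments.\<close>
    have "0 < (\<Sum>B\<in>matroid_bases \<I>. ?p B)"
      using finite_bases matroid_basis_exists p by (intro sum_pos)
    then show ?thesis
      using b sum_prod_one_plus_inverse_le_card_indep
      by (intro mult_left_mono ln_mono divide_right_mono) auto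
  qed
  finally show ?thesis using b by (simp add: field_simps)
qed

end

theorem theorem1p7:
  fixes E :: "'a set" and \<I> :: "'a set set" and r :: nat
  assumes "matroid E \<I>"
    and "r = matroid_rank \<I>"
    and "r \<ge> 1"
  shows "ln (real (card \<I>) / real (card (indep_of_size \<I> r)))
           \<ge> real (card (indep_of_size \<I> (r - 1))) / real (card (indep_of_size \<I> r))
             * (1 / real (card (indep_of_size \<I> (r - 1)))
                * (\<Sum>F\<in>indep_of_size \<I> (r - 1).
                     real (num_bases_containing \<I> F)
                     * ln (1 + 1 / real (num_bases_containing \<I> F))))
       \<and> (\<forall>\<delta>::real. \<delta> > 0 \<and>
             (\<forall>F\<in>indep_of_size \<I> (r - 1). real (num_bases_containing \<I> F) \<ge> \<delta>) \<longrightarrow>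
           ln (real (card \<I>) / real (card (indep_of_size \<I> r)))
             \<ge> real (card (indep_of_size \<I> (r - 1))) / real (card (indep_of_size \<I> r))
               * (\<delta> * ln (1 + 1 / \<delta>)))
       \<and> real (card \<I>) / real (card (indep_of_size \<I> r))
           \<ge> 2 powr (real (card (indep_of_size \<I> (r - 1))) / real (card (indep_of_size \<I> r)))"
proof -
  interpret matroid E \<I> by fact
  let ?a = "real (card (indep_of_size \<I> (r - 1)))"
  let ?b = "real (card (indep_of_size \<I> r))"
  let ?L = "ln (real (card \<I>) / ?b)"
  let ?d = "\<lambda>F. real (num_bases_containing \<I> F)"
  let ?s = "\<Sum>F\<in>indep_of_size \<I> (r - 1). ?d F * ln (1 + 1 / ?d F)"
  have bases: "matroid_bases \<I> = indep_of_size \<I> r"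
    using assms(2) bases_eq_indep_of_rank by simp
  obtain B where B: "B \<in> matroid_bases \<I>" using matroid_basis_exists by blast
  have b: "0 < ?b" using B finite_bases unfolding bases by (auto simp: card_gt_0_iff)
  have "0 < card \<I>" using empty_indep finite_indep_family by (auto simp: card_gt_0_iff)
  have "card B = r" using card_matroid_basis[OF B] assms(2) by simp
  \<comment> \<open>This witness shows \<open>?a\<close> to be nonzero, so that \<open>?a\<close>
    cancels against \<open>1 / ?a\<close> in the first inequality.\<close>
  then obtain F where "F \<subseteq> B" "card F = r - 1"
    using obtain_subset_with_card_n[of "r - 1" B] by auto
  then have "F \<in> indep_of_size \<I> (r - 1)"
    using indep_hereditary[OF basis_indep[OF B]] by (auto simp: indep_of_size_def)
  moreover have "finite (indep_of_size \<I> (r - 1))"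
    using finite_indep_family by (simp add: indep_of_size_def)
  ultimately have a: "0 < ?a" by (auto simp: card_gt_0_iff)
  have main: "?s / ?b \<le> ?L"
    using ln_card_indep_ratio_ge assms(2,3) bases by simp
  have lower: "?a / ?b * (\<delta> * ln (1 + 1 / \<delta>)) \<le> ?L"
    if \<delta>: "\<delta> > 0" "\<forall>F\<in>indep_of_size \<I> (r - 1). \<delta> \<le> ?d F" for \<delta>
  proof -
    have "?a * (\<delta> * ln (1 + 1 / \<delta>)) = (\<Sum>F\<in>indep_of_size \<I> (r - 1). \<delta> * ln (1 + 1 / \<delta>))"
      by simp
    also have "\<dots> \<le> ?s" using \<delta> by (intro sum_mono mult_ln_one_plus_inverse_mono) auto
    finally have "?a * (\<delta> * ln (1 + 1 / \<delta>)) / ?b \<le> ?s / ?b" by (rule divide_right_mono) simp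
    then show ?thesis using main by simp
  qed
  have "1 \<le> ?d F" if "F \<in> indep_of_size \<I> (r - 1)" for F
    using num_bases_containing_pos[of F] that by (simp add: indep_of_size_def)
  \<comment> \<open>With \<open>\<delta> = 1\<close> the factor
    \<open>\<delta> * ln (1 + 1 / \<delta>)\<close> is \<open>ln 2\<close>; exponentiating then
    gives the power of two.\<close>
  then have "?a / ?b * ln 2 \<le> ?L" using lower[of 1] by simp
  then have "2 powr (?a / ?b) \<le> real (card \<I>) / ?b"
    using b \<open>0 < card \<I>\<close> by (simp add: powr_def ln_ge_iff)
  moreover have "?a / ?b * (1 / ?a * ?s) \<le> ?L" using a main by simp
  ultimately show ?thesis using lower by blast
qed

end
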